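(* Let $k$ be an algebraically closed field, let $R=k[x_1,\ldots,x_n]$ with $n\ge1$, and let $q\ge1$ be an integer. Then there is no ideal $J$ of $R$ such that $$\Phi^{*}_q(I)=I+J$$ for every ideal $I$ of $R$.
   Context: For $a=(a_1,\ldots,a_n)\in k^n$, $\mathfrak{m}_a=(x_1-a_1,\ldots,x_n-a_n)\subseteq R$. For every integer $q\ge1$ and every ideal $I$ of $R$, $\Phi^{*}_q(I)=\bigcap_{a\in k^n}(I+\mathfrak{m}_a^q)$. *)

theory Defs
  imports
    "HOL-Library.Poly_Mapping"
    "HOL-Library.Set_Algebras"
    "HOL-Computational_Algebra.Polynomial"
begin

text \<open>
  The polynomial ring $k[x_1,\ldots,x_n]$: finitely supported functions from exponent vectors to
  coefficients, with convolution as multiplication. The variables are indexed by a finite type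
  \<open>'n\<close>, so that $n$ is the cardinality of \<open>'n\<close>; as types are nonempty, $n \ge 1$.
\<close>
type_synonym ('n, 'k) mpoly = "('n \<Rightarrow>\<^sub>0 nat) \<Rightarrow>\<^sub>0 'k"

definition var :: "'n \<Rightarrow> ('n, 'k::comm_ring_1) mpoly"
  where "var i = Poly_Mapping.single (Poly_Mapping.single i 1) 1"

definition const :: "'k \<Rightarrow> ('n, 'k::comm_ring_1) mpoly"
  where "const c = Poly_Mapping.single 0 c"

text \<open>
  Ideals are the submodules of a commutative ring regarded as a module over itself. The locale
  is not interpreted globally because its rule \<open>scale_scale\<close> would become a simp rule that
  reassociates multiplication.
\<close>
lemma module_mult: "module ((*) :: 'a::comm_ring_1 \<Rightarrow> 'a \<Rightarrow> 'a)"
  by standard (simp_all add: algebra_simps)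

definition is_ideal :: "'a::comm_ring_1 set \<Rightarrow> bool"
  where "is_ideal I \<longleftrightarrow> module.subspace (*) I"

definition ideal_gen :: "'a::comm_ring_1 set \<Rightarrow> 'a set"
  where "ideal_gen S = module.span (*) S"

text \<open>
  Here \<open>I * J\<close> is the elementwise product of sets, which need not be closed under addition; the
  product of ideals is the ideal it generates. The sum of two ideals is their elementwise sum
  \<open>I + J\<close>.
\<close>
primrec ideal_power :: "'a::comm_ring_1 set \<Rightarrow> nat \<Rightarrow> 'a set"
  where
    "ideal_power I 0 = UNIV"
  | "ideal_power I (Suc q) = ideal_gen (I * ideal_power I q)"

definition point_ideal :: "('n \<Rightarrow> 'k) \<Rightarrow> ('n, 'k::comm_ring_1) mpoly set"
  where "point_ideal a = ideal_gen (range (\<lambda>i. var i - const (a i)))"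

definition Phi_star :: "nat \<Rightarrow> ('n, 'k::comm_ring_1) mpoly set \<Rightarrow> ('n, 'k) mpoly set"
  where "Phi_star q I = (\<Inter>a. I + ideal_power (point_ideal a) q)"

end

theory Submission
  imports Defs
begin

text \<open>
  Suppose that \<open>J\<close> works for every ideal. Taking \<open>I = 0\<close> gives \<open>J \<subseteq> \<Inter>a. \<mm>\<^sub>a\<^sup>q\<close>, so the elements
  of \<open>J\<close> vanish at every point of $k^n$ (this is where \<open>q \<ge> 1\<close> is used).

  Now let \<open>x\<close> be one of the variables and take \<open>I = (x\<^sup>q\<^sup>+\<^sup>1)\<close>. Then \<open>x\<^sup>q\<close> lies in \<open>I + \<mm>\<^sub>a\<^sup>q\<close> for every
  point \<open>a\<close>, for two different reasons: if the \<open>x\<close>-coordinate \<open>c\<close> of \<open>a\<close> is zero, then \<open>x\<^sup>q\<close> is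
  already in \<open>\<mm>\<^sub>a\<^sup>q\<close>; otherwise \<open>x\<close> and \<open>x - c\<close> are comaximal, hence so are their powers, and
  \<open>I + \<mm>\<^sub>a\<^sup>q\<close> is the whole ring (\<open>var_power_in_Phi_star\<close>).
  Therefore \<open>x\<^sup>q = g x\<^sup>q\<^sup>+\<^sup>1 + j\<close> with \<open>j \<in> J\<close>.

  To contradict this it is enough to look at the diagonal line. Substituting a single
  indeterminate \<open>X\<close> for all variables is a ring homomorphism \<open>diag\<close> to \<open>k[X]\<close>, and it sends \<open>j\<close> to
  a univariate polynomial that vanishes on all of \<open>k\<close>. Over an algebraically closed field such
  a polynomial is zero (\<open>poly_vanishing_everywhere\<close>), so \<open>X\<^sup>q\<close> would be a multiple of \<open>X\<^sup>q\<^sup>+\<^sup>1\<close>.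
\<close>

section \<open>Ideals and their powers\<close>

lemma is_ideal_gen: "is_ideal (ideal_gen S)"
  unfolding is_ideal_def ideal_gen_def by (rule module.subspace_span[OF module_mult])

lemma is_ideal_zero: "is_ideal {0}"
  unfolding is_ideal_def by (rule module.subspace_single_0[OF module_mult])

lemma ideal_gen_base: "x \<in> S \<Longrightarrow> x \<in> ideal_gen S"
  unfolding ideal_gen_def by (rule module.span_base[OF module_mult])

lemma ideal_gen_minimal: "S \<subseteq> I \<Longrightarrow> is_ideal I \<Longrightarrow> ideal_gen S \<subseteq> I"
  unfolding ideal_gen_def is_ideal_def by (rule module.span_minimal[OF module_mult])

lemma ideal_gen_singleton: "ideal_gen {x} = range (\<lambda>g. g * x)"
  unfolding ideal_gen_def by (rule module.span_singleton[OF module_mult])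

lemma ideal_mult_left: "is_ideal I \<Longrightarrow> x \<in> I \<Longrightarrow> r * x \<in> I"
  unfolding is_ideal_def by (rule module.subspace_scale[OF module_mult])

lemma is_ideal_power: "is_ideal (ideal_power I q)"
  by (cases q) (simp_all add: is_ideal_gen, simp add: is_ideal_def module.subspace_UNIV[OF module_mult])

lemma ideal_power_subset:
  assumes "is_ideal I" and "q \<ge> 1"
  shows "ideal_power I q \<subseteq> I"
proof (cases q)
  case (Suc p)
  have "I * ideal_power I p \<subseteq> I"
    using ideal_mult_left[OF assms(1)] by (auto simp: set_times_def mult.commute)
  with Suc show ?thesis
    using assms(1) by (simp add: ideal_gen_minimal)
qed (use assms(2) in simp)

lemma power_in_ideal_power: "x \<in> I \<Longrightarrow> x ^ q \<in> ideal_power I q"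
  by (induction q) (auto intro!: ideal_gen_base set_times_intro)

text \<open>
  Comaximality of \<open>z\<close> and \<open>1 - z\<close> passes to their powers. With \<open>s = 1 - z ^ m\<close>, the element
  \<open>1 - z\<close> divides \<open>s\<close>, so \<open>(1 - z) ^ n\<close> divides \<open>s ^ n\<close>; and \<open>z ^ m = 1 - s\<close> divides \<open>1 - s ^ n\<close>.
\<close>
lemma powers_comaximal:
  fixes z :: "'a::comm_ring_1"
  obtains u w where "1 = u * z ^ m + w * (1 - z) ^ n"
proof -
  define s where "s = 1 - z ^ m"
  obtain w where w: "s = (1 - z) * w"
    unfolding s_def by (metis one_diff_power_eq)
  obtain u where "1 - s ^ n = (1 - s) * u"
    by (metis one_diff_power_eq)
  moreover have "1 - s = z ^ m"
    by (simp add: s_def)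
  moreover have "s ^ n = w ^ n * (1 - z) ^ n"
    by (simp add: w power_mult_distrib mult.commute)
  ultimately have "1 = u * z ^ m + w ^ n * (1 - z) ^ n"
    by (simp add: algebra_simps)
  then show thesis by (rule that)
qed

section \<open>The operator on the ideal of a power of a variable\<close>

text \<open>
  The exponent \<open>q + 1\<close> is chosen so that \<open>x\<^sup>q\<close> is missing from the ideal itself, while its zero set
  is the hyperplane \<open>x = 0\<close>. On that hyperplane \<open>x\<^sup>q\<close> belongs to the \<open>q\<close>-th power of the ideal of
  the point; off it, the ideal and that power generate the unit ideal.
\<close>
lemma var_power_in_Phi_star:
  fixes i :: 'n
  shows "var i ^ q \<in> Phi_star q (ideal_gen {(var i :: ('n, 'k::field) mpoly) ^ Suc q})"
  unfolding Phi_star_def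
proof
  fix a :: "'n \<Rightarrow> 'k"
  let ?x = "var i :: ('n, 'k) mpoly" and ?c = "const (a i) :: ('n, 'k) mpoly"
  let ?I = "ideal_gen {?x ^ Suc q}" and ?M = "ideal_power (point_ideal a) q"
  have M: "(?x - ?c) ^ q \<in> ?M"
    by (intro power_in_ideal_power) (simp add: point_ideal_def ideal_gen_base)
  show "?x ^ q \<in> ?I + ?M"
  proof (cases "a i = 0")
    case True
    have "0 \<in> ?I"
      using ideal_mult_left[OF is_ideal_gen ideal_gen_base, of "?x ^ Suc q" "{?x ^ Suc q}" 0] by simp
    moreover have "?x ^ q \<in> ?M"
      using M True by (simp add: const_def)
    ultimately show ?thesis
      using set_plus_intro[of 0 ?I "?x ^ q" ?M] by simp
  next
    case False
    \<comment> \<open>Rescale the variable so that the constant \<open>a i\<close> becomes \<open>1\<close>.\<close>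
    define d where "d = (const (inverse (a i)) :: ('n, 'k) mpoly)"
    have "d * ?c = 1"
      using False by (simp add: d_def const_def mult_single)
    then have z: "1 - d * ?x = - d * (?x - ?c)"
      by (simp add: algebra_simps)
    obtain u w where "1 = u * (d * ?x) ^ Suc q + w * (1 - d * ?x) ^ q"
      by (rule powers_comaximal)
    then have "?x ^ q * 1 = ?x ^ q * (u * (d * ?x) ^ Suc q + w * (- d * (?x - ?c)) ^ q)"
      by (simp only: z)
    then have "?x ^ q = (?x ^ q * u * d ^ Suc q) * ?x ^ Suc q + (?x ^ q * w * (- d) ^ q) * (?x - ?c) ^ q"
      by (simp only: power_mult_distrib distrib_left mult_1_right mult.assoc)
    moreover have "(?x ^ q * u * d ^ Suc q) * ?x ^ Suc q \<in> ?I"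
      by (intro ideal_mult_left is_ideal_gen ideal_gen_base) simp
    moreover have "(?x ^ q * w * (- d) ^ q) * (?x - ?c) ^ q \<in> ?M"
      by (intro ideal_mult_left is_ideal_power M)
    ultimately show ?thesis
      by (metis set_plus_intro)
  qed
qed

section \<open>Restriction to the diagonal\<close>

text \<open>
  The image of a polynomial under the substitution of \<open>X\<close> for every variable: a monomial goes to
  the power of \<open>X\<close> given by its total degree.
\<close>
definition diag :: "('n::finite, 'k::comm_ring_1) mpoly \<Rightarrow> 'k poly"
  where "diag f =
    (\<Sum>m\<in>Poly_Mapping.keys f. monom (Poly_Mapping.lookup f m) (\<Sum>i\<in>UNIV. Poly_Mapping.lookup m i))"

lemma diag_zero: "diag 0 = 0"
  by (simp add: diag_def)

lemma diag_add: "diag (f + g) = diag f + diag g"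
  unfolding diag_def by (rule setsum_keys_plus_distrib) (simp_all add: add_monom)

lemma diag_single:
  "diag (Poly_Mapping.single m c) = monom c (\<Sum>i\<in>UNIV. Poly_Mapping.lookup m i)"
  by (simp add: diag_def)

lemma diag_sum: "diag (\<Sum>a\<in>A. f a) = (\<Sum>a\<in>A. diag (f a))"
  by (induction A rule: infinite_finite_induct) (simp_all add: diag_zero diag_add)

lemma poly_mapping_eq_sum_single:
  "f = (\<Sum>m\<in>Poly_Mapping.keys f. Poly_Mapping.single m (Poly_Mapping.lookup f m))"
  by (rule poly_mapping_eqI) (simp add: lookup_sum lookup_single when_def in_keys_iff)

lemma diag_mult: "diag (f * g) = diag f * diag g"
proof -
  let ?deg = "\<lambda>m. \<Sum>i\<in>UNIV. Poly_Mapping.lookup m i"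
  let ?s = "\<lambda>f m. Poly_Mapping.single m (Poly_Mapping.lookup f m)"
  have "f * g = (\<Sum>m\<in>Poly_Mapping.keys f. \<Sum>l\<in>Poly_Mapping.keys g. ?s f m * ?s g l)"
    by (subst (1) poly_mapping_eq_sum_single[of f], subst (1) poly_mapping_eq_sum_single[of g])
       (rule sum_product)
  then have "diag (f * g) = (\<Sum>m\<in>Poly_Mapping.keys f. \<Sum>l\<in>Poly_Mapping.keys g.
      monom (Poly_Mapping.lookup f m) (?deg m) * monom (Poly_Mapping.lookup g l) (?deg l))"
    by (simp add: diag_sum mult_single diag_single mult_monom lookup_add sum.distrib)
  then show ?thesis
    by (simp add: diag_def sum_product)
qed

lemma diag_const: "diag (const c) = [:c:]"
  by (simp add: const_def diag_single monom_0)

lemma diag_var: "diag (var i) = monom 1 1"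
  by (simp add: var_def diag_single lookup_single when_def)

lemma diag_diff: "diag (f - g) = diag f - diag g"
  using diag_add[of "f - g" g] by (simp add: algebra_simps)

lemma diag_var_power: "diag (var i ^ n) = monom 1 n"
proof (induction n)
  case 0
  have "diag 1 = 1"
    using diag_const[of 1] by (simp add: const_def one_pCons)
  then show ?case
    by simp
next
  case (Suc n)
  then show ?case
    by (simp add: diag_mult diag_var mult_monom)
qed

lemma diag_point_ideal:
  assumes "f \<in> point_ideal (\<lambda>_. t)"
  shows "poly (diag f) t = 0"
proof -
  have "is_ideal {f. poly (diag f) t = 0}"
    unfolding is_ideal_def
    by (rule module.subspaceI[OF module_mult]) (simp_all add: diag_zero diag_add diag_mult)
  moreover have "range (\<lambda>i. var i - const t) \<subseteq> {f. poly (diag f) t = 0}"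
    by (auto simp: diag_diff diag_var diag_const poly_monom)
  ultimately show ?thesis
    using assms ideal_gen_minimal unfolding point_ideal_def by blast
qed

text \<open>
  If \<open>p \<noteq> 0\<close>, the nonconstant polynomial \<open>1 + X p\<close> has a root, and \<open>p\<close> cannot vanish there.
\<close>
lemma poly_vanishing_everywhere:
  fixes p :: "'k::alg_closed_field poly"
  assumes "\<And>t. poly p t = 0"
  shows "p = 0"
proof (rule ccontr)
  assume "p \<noteq> 0"
  then have "degree (pCons 1 p) > 0"
    by simp
  then obtain r where "poly (pCons 1 p) r = 0"
    using alg_closed_imp_poly_has_root by blast
  with assms show False
    by simp
qed

section \<open>Nonexistence of the ideal\<close>

theorem theorem6p4:
  fixes q :: nat
  assumes "q \<ge> 1"
  shows "\<not> (\<exists>J :: ('n::finite, 'k::alg_closed_field) mpoly set.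
            is_ideal J \<and>
            (\<forall>I :: ('n, 'k) mpoly set. is_ideal I \<longrightarrow> Phi_star q I = I + J))"
proof
  assume "\<exists>J :: ('n, 'k) mpoly set.
    is_ideal J \<and> (\<forall>I :: ('n, 'k) mpoly set. is_ideal I \<longrightarrow> Phi_star q I = I + J)"
  then obtain J :: "('n, 'k) mpoly set"
    where J: "\<And>I :: ('n, 'k) mpoly set. is_ideal I \<Longrightarrow> Phi_star q I = I + J"
    by blast
  have diag_J: "diag j = 0" if "j \<in> J" for j
  proof (rule poly_vanishing_everywhere)
    fix t :: 'k
    have "j \<in> Phi_star q {0}"
      using J[OF is_ideal_zero] that by simp
    then have "j \<in> ideal_power (point_ideal (\<lambda>_. t)) q"
      by (simp add: Phi_star_def)
    then have "j \<in> point_ideal (\<lambda>_. t)"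
      using ideal_power_subset[OF _ assms] is_ideal_gen unfolding point_ideal_def by blast
    then show "poly (diag j) t = 0"
      by (rule diag_point_ideal)
  qed
  fix i :: 'n
  let ?x = "var i :: ('n, 'k) mpoly"
  have "?x ^ q \<in> ideal_gen {?x ^ Suc q} + J"
    using var_power_in_Phi_star[of i q, where 'k='k] J[OF is_ideal_gen] by blast
  then obtain g j where "j \<in> J" and eq: "?x ^ q = g * ?x ^ Suc q + j"
    unfolding ideal_gen_singleton by (auto elim!: set_plus_elim)
  then have "diag (?x ^ q) = diag g * diag (?x ^ Suc q)"
    by (simp only: eq diag_add diag_mult diag_J add_0_right)
  then have "monom 1 q = diag g * monom 1 (Suc q)"
    by (simp only: diag_var_power)
  then have "coeff (monom 1 q) q = coeff (diag g * monom 1 (Suc q)) q"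
    by (rule arg_cong)
  then show False
    by (simp add: coeff_monom_mult mult.commute[of "diag g"])
qed

end
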